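(* For every even integer $n\ge 4$ there exist $\lambda_1,\lambda_2>0$ with $Z_{\lambda_1}h_n(\tfrac14,\tfrac12)=0$ and $Z_{\lambda_2}h_n(\tfrac16,\tfrac12)=0$, and for every odd integer $n\ge 3$ there exist $\lambda_3,\lambda_4>0$ with $Z_{\lambda_3}h_n(\tfrac16,0)=0$ and $Z_{\lambda_4}h_n(\tfrac14,0)=0$, such that in each case $$\frac{\sqrt{3/2}}{x_0\sqrt{2\pi}}\,\frac{n-1}{\sqrt{n+1}}<\lambda_i<\frac{1}{x_0\sqrt{2\pi}}\sqrt{2n+1},$$ where $x_0=\tfrac14$ for $i=1,4$ and $x_0=\tfrac16$ for $i=2,3$.
   Context: For $n\in\mathbb{Z}_{\ge 0}$ the Hermite function is $h_n(x) = (-1)^n c_n^{-1/2} e^{\pi x^2}\frac{d^n}{dx^n}e^{-2\pi x^2}$, $x\in\mathbb{R}$, with $c_n=(2\pi)^n 2^{n-1/2} n!$. For $\lambda>0$ the Zak transform is $Z_\lambda f(x,\gamma)=\sqrt{\lambda}\sum_{k\in\mathbb{Z}}f(\lambda(x+k))e^{-2\pi i k\gamma}$, $x,\gamma\in\mathbb{R}$. *)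

theory Defs
  imports "HOL-Analysis.Analysis"
begin

definition hermite_const :: "nat \<Rightarrow> real" where
  "hermite_const n = (2 * pi) ^ n * 2 powr (real n - 1 / 2) * fact n"

definition hermite_fun :: "nat \<Rightarrow> real \<Rightarrow> real" where
  "hermite_fun n x =
     (- 1) ^ n * hermite_const n powr (- 1 / 2) * exp (pi * x\<^sup>2) *
     (deriv ^^ n) (\<lambda>t::real. exp (- 2 * pi * t\<^sup>2)) x"

text \<open>
  Note that \<open>\<Sum>\<^sub>\<infinity>\<close> returns 0 when the family is not summable. For Hermite functions
  (a polynomial times a Gaussian) the series converges absolutely, so its vanishing there is genuine.
\<close>

definition zak :: "real \<Rightarrow> (real \<Rightarrow> complex) \<Rightarrow> real \<Rightarrow> real \<Rightarrow> complex" where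
  "zak l f x \<gamma> = complex_of_real (sqrt l) *
     (\<Sum>\<^sub>\<infinity>k\<in>(UNIV::int set).
        f (l * (x + real_of_int k)) * exp (- 2 * complex_of_real pi * \<i> * of_int k * complex_of_real \<gamma>))"

definition lambda_bounds :: "nat \<Rightarrow> real \<Rightarrow> real \<Rightarrow> bool" where
  "lambda_bounds n x0 l \<longleftrightarrow>
     sqrt (3 / 2) / (x0 * sqrt (2 * pi)) * ((real n - 1) / sqrt (real n + 1)) < l \<and>
     l < 1 / (x0 * sqrt (2 * pi)) * sqrt (2 * real n + 1)"

end

theory Submission
  imports Defs "HOL-Real_Asymp.Real_Asymp"
begin

text \<open>In the variable \<open>u = sqrt (2 * pi) * x\<close> the Hermite function is a constant multiple of
\<open>h u = P u * exp (- u\<^sup>2 / 2)\<close>, where \<open>P\<close> is the \<open>n\<close>-th Hermite polynomial, and it solves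
\<open>h'' = (u\<^sup>2 - (2 * n + 1)) * h\<close>. Put \<open>x\<^sub>0 = 1 / d\<close> and \<open>\<mu> = sqrt (2 * pi) * \<lambda> * x\<^sub>0\<close>. Folding
the Zak sum at \<open>k\<close> and \<open>- k - 1\<close> by the parity of \<open>h\<close> turns each of the four Zak transforms into the
same real series \<open>S \<mu> = (\<Sum>j. \<epsilon> ^ j * (h (\<mu> * (d * j + 1)) - h (\<mu> * (d * j + d - 1))))\<close> with
\<open>\<epsilon> = (- 1) ^ (n + 1)\<close>, and the required bounds on \<open>\<lambda>\<close> become
\<open>sqrt (3 / 2) * (n - 1) / sqrt (n + 1) < \<mu> < sqrt (2 * n + 1)\<close>. It thus suffices to find a sign
change of \<open>S\<close> on this interval (\<open>zak_series_zero\<close>).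

The upper end \<open>T = sqrt (2 * n + 1)\<close> is the turning point of the oscillator equation; the sign change
takes place between the largest zero \<open>z\<close> of \<open>P\<close> and \<open>T\<close>. Beyond \<open>T\<close> the function \<open>h\<close> is positive,
and it decays exponentially once \<open>u\<^sup>2 \<ge> 2 * n + 2\<close> (\<open>hermite_psi_decay\<close>). Hence \<open>S \<mu>\<close> differs from
\<open>h \<mu> - h (\<mu> * (d - 1))\<close> by at most half of the second term (\<open>zak_series_approx\<close>). At \<open>\<mu> = z\<close> the first
term vanishes and \<open>S\<close> is negative; at \<open>\<mu> = T\<close> the first term dominates and \<open>S\<close> is positive.

What remains is the lower bound \<open>z \<ge> b = sqrt (3 / 2) * (n - 1) / sqrt (n + 1)\<close>
(\<open>hermite_zero_lower_bound\<close>). This is a Sturm comparison: if \<open>P\<close> had no zero in \<open>{b..}\<close>, then for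
a polynomial \<open>q\<close> with \<open>q b = 0 < q' b\<close> and \<open>q'' - 2 * u * q' + 2 * n * q \<ge> 0\<close> on \<open>{b..}\<close> the weighted
Wronskian \<open>(P * q' - P' * q) * exp (- u\<^sup>2)\<close> would be positive at \<open>b\<close>, nondecreasing, and yet tend
to \<open>0\<close> (\<open>hermite_zero_ge\<close>). A suitable \<open>q\<close> is \<open>u ^ k * (u\<^sup>2 - b\<^sup>2) * (u\<^sup>2 - c) ^ M\<close>, where
\<open>n = 2 * M + 2 + k\<close> with \<open>k \<in> {0, 1}\<close> and \<open>c\<close> is well chosen; it has degree \<open>n\<close>, so the leading terms cancel.\<close>

section \<open>Hermite polynomials\<close>

fun hermite_poly :: "nat \<Rightarrow> real poly" where
  "hermite_poly 0 = 1"
| "hermite_poly (Suc n) = [:0, 2:] * hermite_poly n - pderiv (hermite_poly n)"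

text \<open>The induction carries the equation itself: together with the recurrence, the equation for \<open>n\<close> gives
the derivative of the next polynomial as \<open>2 * (n + 1)\<close> times the present one, and this in turn gives
the equation for \<open>n + 1\<close>.\<close>
lemma hermite_ode:
  "pderiv (pderiv (hermite_poly n)) - [:0, 2:] * pderiv (hermite_poly n)
     + smult (2 * real n) (hermite_poly n) = 0"
proof (induction n)
  case 0
  then show ?case by simp
next
  case (Suc n)
  let ?P = "hermite_poly n"
  have d: "pderiv (hermite_poly (Suc n)) = smult (2 * (real n + 1)) ?P"
  proof -
    have "pderiv (hermite_poly (Suc n))
        = smult 2 ?P + [:0, 2:] * pderiv ?P - pderiv (pderiv ?P)"
      by (simp add: pderiv_diff pderiv_mult pderiv_pCons pderiv_smult)
    also have "\<dots> = smult 2 ?P + smult (2 * real n) ?P"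
      using Suc by (simp add: algebra_simps)
    finally show ?thesis by (simp flip: smult_add_left add: algebra_simps)
  qed
  show ?case
    unfolding d by (simp add: pderiv_smult smult_diff_right algebra_simps)
qed

lemma hermite_ode_at:
  "poly (pderiv (pderiv (hermite_poly n))) u
     = 2 * u * poly (pderiv (hermite_poly n)) u - 2 * real n * poly (hermite_poly n) u"
proof -
  have "poly (pderiv (pderiv (hermite_poly n)) - [:0, 2:] * pderiv (hermite_poly n)
     + smult (2 * real n) (hermite_poly n)) u = 0"
    by (subst hermite_ode) simp
  then show ?thesis by (simp add: algebra_simps)
qed

lemma hermite_parity: "poly (hermite_poly n) (- u) = (- 1) ^ n * poly (hermite_poly n) u"
proof -
  have "pcompose (hermite_poly n) [:0, - 1:] = smult ((- 1) ^ n) (hermite_poly n)"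
  proof (induction n)
    case 0
    then show ?case by (simp add: pcompose_1)
  next
    case (Suc n)
    let ?P = "hermite_poly n"
    have "pcompose (pderiv ?P) [:0, - 1:] = - pderiv (pcompose ?P [:0, - 1:])"
      by (simp add: pderiv_pcompose pderiv_pCons)
    then show ?case
      using Suc by (simp add: pcompose_diff pcompose_mult pcompose_pCons pcompose_smult pderiv_smult
          smult_diff_right mult.commute)
  qed
  then have "poly (pcompose (hermite_poly n) [:0, - 1:]) u
      = poly (smult ((- 1) ^ n) (hermite_poly n)) u" by simp
  then show ?thesis by (simp add: poly_pcompose)
qed

lemma lead_coeff_hermite: "degree (hermite_poly n) = n \<and> lead_coeff (hermite_poly n) = 2 ^ n"
proof (induction n)
  case 0
  then show ?case by simp
next
  case (Suc n)
  let ?P = "hermite_poly n"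
  have c: "coeff (hermite_poly (Suc n)) (Suc n) = 2 ^ Suc n"
    using Suc by (auto simp: coeff_pderiv coeff_eq_0)
  have "degree (hermite_poly (Suc n)) \<le> Suc n"
    using Suc by (auto intro!: degree_diff_le order.trans[OF degree_mult_le]
        simp: degree_pderiv)
  then have "degree (hermite_poly (Suc n)) = Suc n"
    using c by (intro antisym le_degree) simp_all
  then show ?case using c by (simp del: hermite_poly.simps)
qed

section \<open>Polynomials times Gaussians\<close>

lemma poly_le_exp:
  fixes p :: "real poly"
  obtains C N where "C \<ge> 0" "\<And>u. u \<ge> 0 \<Longrightarrow> \<bar>poly p u\<bar> \<le> C * exp (N * u)"
proof -
  have "\<exists>C N. C \<ge> 0 \<and> N \<ge> 0 \<and> (\<forall>u\<ge>0. \<bar>poly p u\<bar> \<le> C * exp (N * u))"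
  proof (induction p)
    case 0
    then show ?case by (auto intro!: exI[of _ 0])
  next
    case (pCons a p)
    then obtain C N where CN: "C \<ge> 0" "N \<ge> 0" "\<And>u. u \<ge> 0 \<Longrightarrow> \<bar>poly p u\<bar> \<le> C * exp (N * u)"
      by auto
    have "\<bar>poly (pCons a p) u\<bar> \<le> (\<bar>a\<bar> + C) * exp ((N + 1) * u)" if u: "u \<ge> 0" for u
    proof -
      have "u * \<bar>poly p u\<bar> \<le> exp u * (C * exp (N * u))"
        using u CN exp_ge_add_one_self[of u] by (intro mult_mono) (linarith | simp)+
      moreover have "\<bar>a\<bar> * 1 \<le> \<bar>a\<bar> * exp ((N + 1) * u)"
        using u CN by (intro mult_left_mono) auto
      ultimately have "\<bar>a\<bar> + u * \<bar>poly p u\<bar> \<le> (\<bar>a\<bar> + C) * exp ((N + 1) * u)"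
        by (simp add: algebra_simps exp_add)
      moreover have "\<bar>poly (pCons a p) u\<bar> \<le> \<bar>a\<bar> + u * \<bar>poly p u\<bar>"
        using u abs_triangle_ineq[of a "u * poly p u"] by (simp add: abs_mult)
      ultimately show ?thesis by linarith
    qed
    then show ?case using CN by (intro exI[of _ "\<bar>a\<bar> + C"] exI[of _ "N + 1"]) auto
  qed
  then show ?thesis using that by blast
qed

definition gauss :: "real poly \<Rightarrow> real \<Rightarrow> real" where
  "gauss p u = poly p u * exp (- u\<^sup>2 / 2)"

lemma gauss_deriv:
  "(gauss p has_real_derivative gauss (pderiv p - [:0, 1:] * p) u) (at u within S)"
  unfolding gauss_def
  by (auto intro!: derivative_eq_intros poly_DERIV[THEN DERIV_subset] simp: algebra_simps)

lemma gauss_bound: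
  obtains C where "C \<ge> 0" "\<And>u. u \<ge> 0 \<Longrightarrow> \<bar>gauss p u\<bar> \<le> C * exp (- u)"
proof -
  obtain C N where CN: "C \<ge> 0" "\<And>u. u \<ge> 0 \<Longrightarrow> \<bar>poly p u\<bar> \<le> C * exp (N * u)"
    using poly_le_exp by blast
  have "\<bar>gauss p u\<bar> \<le> (C * exp ((N + 1)\<^sup>2 / 2)) * exp (- u)" if u: "u \<ge> 0" for u
  proof -
    have "\<bar>gauss p u\<bar> \<le> C * exp (N * u) * exp (- u\<^sup>2 / 2)"
      unfolding gauss_def abs_mult using CN(2)[OF u] by simp
    also have "\<dots> = C * exp (N * u - u\<^sup>2 / 2)"
      by (simp add: exp_add [symmetric])
    also have "\<dots> \<le> C * exp ((N + 1)\<^sup>2 / 2 - u)"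
      using CN(1) zero_le_power2[of "N + 1 - u"]
      by (intro mult_left_mono) (auto simp: power2_eq_square algebra_simps)
    also have "\<dots> = (C * exp ((N + 1)\<^sup>2 / 2)) * exp (- u)"
      by (simp add: mult.assoc flip: exp_add)
    finally show ?thesis .
  qed
  then show ?thesis using that[of "C * exp ((N + 1)\<^sup>2 / 2)"] CN(1) by simp
qed

lemma gauss_exp_tendsto_0:
  assumes "c \<ge> 0"
  shows "((\<lambda>u. exp (- c * u) * gauss p u) \<longlongrightarrow> 0) at_top"
proof -
  obtain C where C: "C \<ge> 0" "\<And>u. u \<ge> 0 \<Longrightarrow> \<bar>gauss p u\<bar> \<le> C * exp (- u)"
    using gauss_bound by blast
  have lim: "((\<lambda>u. C * exp (- u)) \<longlongrightarrow> (0::real)) at_top" by real_asymp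
  show ?thesis
  proof (rule tendsto_rabs_zero_cancel, rule tendsto_sandwich[OF _ _ tendsto_const lim])
    show "\<forall>\<^sub>F u in at_top. \<bar>exp (- c * u) * gauss p u\<bar> \<le> C * exp (- u)"
      using eventually_ge_at_top[of 0]
    proof eventually_elim
      case (elim u)
      have "exp (- c * u) * \<bar>gauss p u\<bar> \<le> 1 * \<bar>gauss p u\<bar>"
        using assms elim by (intro mult_right_mono) auto
      then show ?case using C(2)[OF elim] by (simp add: abs_mult)
    qed
  qed simp
qed

text \<open>This turns a differential inequality and decay at infinity into a sign at a finite point. It serves
both for the decay of the Hermite functions and for the Wronskian comparison.\<close>
lemma nonpos_if_mono_tendsto_0:
  fixes f :: "real \<Rightarrow> real"
  assumes der: "\<And>u. u \<ge> w \<Longrightarrow> (f has_real_derivative f' u) (at u)"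
    and nonneg: "\<And>u. u \<ge> w \<Longrightarrow> f' u \<ge> 0"
    and lim: "(f \<longlongrightarrow> 0) at_top"
  shows "f w \<le> 0"
proof (rule tendsto_lowerbound[OF lim])
  show "\<forall>\<^sub>F u in at_top. f w \<le> f u"
    using eventually_ge_at_top[of w]
  proof eventually_elim
    case (elim u)
    show ?case
      by (rule DERIV_nonneg_imp_nondecreasing[OF elim]) (use der nonneg in force)
  qed
qed simp

definition hermite_psi :: "nat \<Rightarrow> real \<Rightarrow> real" where
  "hermite_psi n = gauss (hermite_poly n)"

lemma hermite_psi_eq_0_iff: "hermite_psi n u = 0 \<longleftrightarrow> poly (hermite_poly n) u = 0"
  and hermite_psi_pos_iff: "hermite_psi n u > 0 \<longleftrightarrow> poly (hermite_poly n) u > 0"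
  by (auto simp: hermite_psi_def gauss_def zero_less_mult_iff)

lemma hermite_psi_parity: "hermite_psi n (- u) = (- 1) ^ n * hermite_psi n u"
  by (simp add: hermite_psi_def gauss_def hermite_parity)

text \<open>Since \<open>h'' - c\<^sup>2 * h \<ge> 0\<close> on \<open>{w..}\<close>, the function \<open>exp (- c * u) * (h' + c * h)\<close> is nondecreasing there
and tends to \<open>0\<close>, so it is nonpositive; hence \<open>exp (c * u) * h\<close> is nonincreasing. The case \<open>c = 0\<close> is
monotonicity beyond the turning point, the case \<open>c = 1\<close> is exponential decay.\<close>
lemma hermite_psi_decay:
  assumes pos: "\<And>u. u \<ge> w \<Longrightarrow> hermite_psi n u \<ge> 0"
    and w: "w \<ge> 0" "w\<^sup>2 \<ge> 2 * real n + 1 + c\<^sup>2" and c: "c \<ge> 0"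
    and uv: "w \<le> u" "u \<le> v"
  shows "hermite_psi n v \<le> exp (- c * (v - u)) * hermite_psi n u"
proof -
  let ?P = "hermite_poly n"
  define D where "D = pderiv ?P - [:0, 1:] * ?P"
  have D1: "(hermite_psi n has_real_derivative gauss D t) (at t)" for t
    unfolding hermite_psi_def D_def by (rule gauss_deriv)
  have D2: "(gauss D has_real_derivative (t\<^sup>2 - (2 * real n + 1)) * hermite_psi n t) (at t)" for t
  proof -
    have "gauss (pderiv D - [:0, 1:] * D) t = (t\<^sup>2 - (2 * real n + 1)) * hermite_psi n t"
      unfolding D_def gauss_def hermite_psi_def
      by (simp add: pderiv_diff pderiv_mult pderiv_pCons hermite_ode_at power2_eq_square
          algebra_simps)
    then show ?thesis using gauss_deriv[of D t UNIV] by simp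
  qed
  have slope: "gauss D t + c * hermite_psi n t \<le> 0" if t: "w \<le> t" for t
  proof -
    have "exp (- c * t) * (gauss D t + c * hermite_psi n t) \<le> 0"
    proof (rule nonpos_if_mono_tendsto_0[where w = t
          and f = "\<lambda>x. exp (- c * x) * (gauss D x + c * hermite_psi n x)"])
      fix x assume x: "t \<le> x"
      show "((\<lambda>x. exp (- c * x) * (gauss D x + c * hermite_psi n x)) has_real_derivative
          exp (- c * x) * ((x\<^sup>2 - (2 * real n + 1) - c\<^sup>2) * hermite_psi n x)) (at x)"
        by (auto intro!: derivative_eq_intros D1 D2 simp: algebra_simps power2_eq_square)
      have "w\<^sup>2 \<le> x\<^sup>2" using w t x by (intro power_mono) auto
      with w have "x\<^sup>2 - (2 * real n + 1) - c\<^sup>2 \<ge> 0" by linarith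
      then show "exp (- c * x) * ((x\<^sup>2 - (2 * real n + 1) - c\<^sup>2) * hermite_psi n x) \<ge> 0"
        using t x pos[of x] by (intro mult_nonneg_nonneg) auto
    next
      have "((\<lambda>x. exp (- c * x) * gauss D x + c * (exp (- c * x) * hermite_psi n x))
          \<longlongrightarrow> 0 + c * 0) at_top"
        unfolding hermite_psi_def by (intro tendsto_intros gauss_exp_tendsto_0 c)
      then show "((\<lambda>x. exp (- c * x) * (gauss D x + c * hermite_psi n x)) \<longlongrightarrow> 0) at_top"
        by (simp add: algebra_simps)
    qed
    then show ?thesis by (simp add: mult_le_0_iff)
  qed
  have "exp (c * v) * hermite_psi n v \<le> exp (c * u) * hermite_psi n u"
  proof (rule DERIV_nonpos_imp_nonincreasing[OF uv(2)])
    fix t assume t: "u \<le> t" "t \<le> v"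
    have "((\<lambda>t. exp (c * t) * hermite_psi n t) has_real_derivative
        exp (c * t) * (gauss D t + c * hermite_psi n t)) (at t)"
      by (auto intro!: derivative_eq_intros D1 simp: algebra_simps)
    moreover have "exp (c * t) * (gauss D t + c * hermite_psi n t) \<le> 0"
      using slope[of t] uv t by (simp add: mult_le_0_iff)
    ultimately show "\<exists>y. ((\<lambda>t. exp (c * t) * hermite_psi n t) has_real_derivative y) (at t) \<and> y \<le> 0"
      by blast
  qed
  then have "exp (- c * v) * (exp (c * v) * hermite_psi n v)
      \<le> exp (- c * v) * (exp (c * u) * hermite_psi n u)"
    by (intro mult_left_mono) auto
  then show ?thesis by (simp add: algebra_simps exp_diff exp_minus divide_simps)
qed

section \<open>A lower bound for the largest zero\<close>

lemma hermite_pos_beyond_zeros: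
  assumes "\<And>u. u \<ge> b \<Longrightarrow> poly (hermite_poly n) u \<noteq> 0" and "u \<ge> b"
  shows "poly (hermite_poly n) u > 0"
proof (rule ccontr)
  assume "\<not> poly (hermite_poly n) u > 0"
  then have neg: "poly (hermite_poly n) u < 0" using assms by (metis linorder_cases)
  obtain N where N: "\<And>x. x \<ge> N \<Longrightarrow> poly (hermite_poly n) x \<ge> lead_coeff (hermite_poly n)"
    using poly_pinfty_gt_lc[of "hermite_poly n"] lead_coeff_hermite[of n]
    by (metis zero_less_numeral zero_less_power)
  have pos: "poly (hermite_poly n) (max N (u + 1)) > 0"
    using N[of "max N (u + 1)"] lead_coeff_hermite[of n]
    by (metis max.cobounded1 order_less_le_trans zero_less_numeral zero_less_power)
  have "u < max N (u + 1)" by linarith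
  then obtain x where "u < x" "poly (hermite_poly n) x = 0"
    using poly_IVT_pos[OF _ neg pos] by blast
  with assms show False by fastforce
qed

text \<open>The weighted Wronskian of \<open>P\<close> and \<open>q\<close> has derivative \<open>P * (q'' - 2 * u * q' + 2 * n * q) * exp (- u\<^sup>2)\<close>.
If \<open>P\<close> were positive on \<open>{b..}\<close>, the Wronskian would increase from a positive value to the limit \<open>0\<close>.\<close>
lemma hermite_zero_ge:
  assumes q0: "poly q b = 0" and q1: "poly (pderiv q) b > 0"
    and sub: "\<And>u. u \<ge> b \<Longrightarrow>
      poly (pderiv (pderiv q)) u - 2 * u * poly (pderiv q) u + 2 * real n * poly q u \<ge> 0"
  shows "\<exists>z\<ge>b. poly (hermite_poly n) z = 0"
proof (rule ccontr)
  let ?P = "hermite_poly n"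
  assume "\<not> ?thesis"
  then have pos: "poly ?P u > 0" if "u \<ge> b" for u
    using hermite_pos_beyond_zeros that by blast
  define V where "V = ?P * pderiv q - pderiv ?P * q"
  define W where "W = (\<lambda>u. poly V u * exp (- u\<^sup>2))"
  have "W b \<le> 0"
  proof (rule nonpos_if_mono_tendsto_0[where f = W and w = b])
    fix u assume u: "u \<ge> b"
    let ?L = "poly (pderiv (pderiv q)) u - 2 * u * poly (pderiv q) u + 2 * real n * poly q u"
    have "(W has_real_derivative (poly (pderiv V) u - 2 * u * poly V u) * exp (- u\<^sup>2)) (at u)"
      unfolding W_def by (auto intro!: derivative_eq_intros simp: algebra_simps)
    moreover have "poly (pderiv V) u - 2 * u * poly V u = poly ?P u * ?L"
      by (simp add: V_def pderiv_diff pderiv_mult hermite_ode_at algebra_simps)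
    ultimately show "(W has_real_derivative poly ?P u * ?L * exp (- u\<^sup>2)) (at u)" by simp
    show "poly ?P u * ?L * exp (- u\<^sup>2) \<ge> 0"
      using pos[OF u] sub[OF u] by simp
  next
    have "((\<lambda>u. exp (- 0 * u) * gauss V u * exp (- u\<^sup>2 / 2)) \<longlongrightarrow> 0 * 0) at_top"
      by (intro tendsto_mult gauss_exp_tendsto_0) (simp, real_asymp)
    then show "(W \<longlongrightarrow> 0) at_top"
      by (simp add: W_def gauss_def mult.assoc flip: exp_add)
  qed
  moreover have "W b > 0"
    using q0 q1 pos[of b] by (simp add: W_def V_def)
  ultimately show False by simp
qed

text \<open>In the variable \<open>y = u\<^sup>2\<close> the Hermite operator becomes the Laguerre operator
\<open>y * R'' + (a - y) * R' + (M + 1) * R\<close> with \<open>a\<close> equal to \<open>1 / 2\<close> or \<open>3 / 2\<close>. For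
\<open>R = (y - Y) * (y - c) ^ M\<close> and \<open>z = y - c\<close>, multiplying it by \<open>z\<^sup>2 / (y - c) ^ M\<close> leaves a quadratic
polynomial in \<open>z\<close>, because the cubic terms cancel. Writing \<open>e = Y - c\<close>, the condition
\<open>e * (Y - a) = 2 * M * Y\<close> says that \<open>z = e\<close>, that is \<open>y = Y\<close>, is a root of this quadratic. The other factor is linear
in \<open>z\<close>, and the assumption on \<open>M * e\<close> makes its slope nonnegative.\<close>
lemma poly_subsolution:
  fixes Y a e :: real and M :: nat
  defines "p \<equiv> [:- (Y - e), 1:] ^ M"
  defines "R \<equiv> [:- Y, 1:] * p"
  assumes e: "e > 0" "e * (Y - a) = 2 * real M * Y" 
    and slope: "real M * e \<ge> (real M + 1) * (Y - real M - a)"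
    and cY: "e \<le> Y" and y: "y \<ge> Y"
  shows "y * poly (pderiv (pderiv R)) y + (a - y) * poly (pderiv R) y
           + (real M + 1) * poly R y \<ge> 0"
proof -
  define z where "z = y - (Y - e)"
  define A where "A = real M * e - (real M + 1) * (Y - real M - a)"
  let ?P = "poly p y" and ?P' = "poly (pderiv p) y" and ?P'' = "poly (pderiv (pderiv p)) y"
  have z: "z \<ge> e" using y by (simp add: z_def)
  \<comment> \<open>The logarithmic derivative of \<open>p\<close> is \<open>M / z\<close>; differentiating this relation gives \<open>p''\<close>.\<close>
  have log: "[:- (Y - e), 1:] * pderiv p = smult (real M) p"
    unfolding p_def
    by (cases M) (simp_all add: pderiv_power_Suc pderiv_pCons power_Suc[symmetric]
        del: mult_pCons_left power_Suc)
  have "z * ?P' = poly ([:- (Y - e), 1:] * pderiv p) y" by (simp add: z_def algebra_simps)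
  then have d1: "z * ?P' = real M * ?P" by (simp only: log poly_smult)
  have "?P' + z * ?P'' = poly (pderiv ([:- (Y - e), 1:] * pderiv p)) y"
    by (simp only: pderiv_mult) (simp add: z_def pderiv_pCons algebra_simps)
  then have d2: "?P' + z * ?P'' = real M * ?P'" by (simp only: log pderiv_smult poly_smult)
  let ?L = "y * poly (pderiv (pderiv R)) y + (a - y) * poly (pderiv R) y + (real M + 1) * poly R y"
  have "z * ?P'' = (real M - 1) * ?P'" using d2 by (simp add: algebra_simps)
  then have "z\<^sup>2 * ?P'' = (real M - 1) * (z * ?P')" by (simp add: power2_eq_square)
  then have d3: "z\<^sup>2 * ?P'' = (real M - 1) * real M * ?P" by (simp add: d1)
  have pR: "pderiv R = p + [:- Y, 1:] * pderiv p"
    unfolding R_def by (simp only: pderiv_mult) (simp add: pderiv_pCons)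
  have ppR: "pderiv (pderiv R) = pderiv p + pderiv p + [:- Y, 1:] * pderiv (pderiv p)"
    unfolding pR by (simp only: pderiv_mult pderiv_add) (simp add: pderiv_pCons)
  have R': "poly (pderiv R) y = ?P + (y - Y) * ?P'"
    and R'': "poly (pderiv (pderiv R)) y = 2 * ?P' + (y - Y) * ?P''"
    and R0: "poly R y = (y - Y) * ?P"
    unfolding ppR unfolding pR unfolding R_def by (simp_all add: algebra_simps)
  have "z\<^sup>2 * ?L = 2 * y * z * (z * ?P') + y * (y - Y) * (z\<^sup>2 * ?P'')
      + (a - y) * (z\<^sup>2 * ?P + (y - Y) * z * (z * ?P')) + (real M + 1) * (y - Y) * z\<^sup>2 * ?P"
    unfolding R' R'' R0 by (simp add: algebra_simps power2_eq_square)
  also have "\<dots> = ?P * (2 * y * z * real M + y * (y - Y) * (real M - 1) * real M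
      + (a - y) * (z\<^sup>2 + (y - Y) * z * real M) + (real M + 1) * (y - Y) * z\<^sup>2)"
    unfolding d1 d3 by (simp add: algebra_simps)
  also have "2 * y * z * real M + y * (y - Y) * (real M - 1) * real M
      + (a - y) * (z\<^sup>2 + (y - Y) * z * real M) + (real M + 1) * (y - Y) * z\<^sup>2
      = (z - e) * (A * z + real M * (real M - 1) * (Y - e))"
  proof -
    have y: "y = z + Y - e" by (simp add: z_def)
    show ?thesis using e(2) unfolding y A_def by algebra
  qed
  finally have "z\<^sup>2 * ?L = ?P * ((z - e) * (A * z + real M * (real M - 1) * (Y - e)))" .
  moreover have "?P \<ge> 0" using z e by (simp add: p_def z_def poly_power)
  moreover have "A \<ge> 0" using slope by (simp add: A_def)
  moreover have "real M * (real M - 1) \<ge> 0" by (cases M) auto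
  ultimately have "z\<^sup>2 * ?L \<ge> 0" using z e cY by (auto intro!: mult_nonneg_nonneg add_nonneg_nonneg)
  then show ?thesis using z e by (simp add: zero_le_mult_iff)
qed

lemma hermite_zero_ge_of_params:
  fixes b e :: real and M k :: nat
  assumes k: "k \<in> {0, 1}" and b: "b > 0"
    and e: "e > 0" "e * (b\<^sup>2 - (real k + 1 / 2)) = 2 * real M * b\<^sup>2" 
    and slope: "real M * e \<ge> (real M + 1) * (b\<^sup>2 - real M - (real k + 1 / 2))"
    and cY: "e \<le> b\<^sup>2"
  shows "\<exists>z\<ge>b. poly (hermite_poly (2 * (M + 1) + k)) z = 0"
proof -
  define p where "p = [:- (b\<^sup>2 - e), 1:] ^ M"
  define R where "R = [:- b\<^sup>2, 1:] * p"
  define sq :: "real poly" where "sq = [:0, 0, 1:]"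
  define q where "q = [:0, 1:] ^ k * pcompose R sq"
  have sq': "pderiv sq = [:0, 2:]" by (simp add: sq_def pderiv_pCons)
  have sq: "poly sq u = u\<^sup>2" for u by (simp add: sq_def power2_eq_square)
  have comp: "pderiv (pcompose S sq) = pcompose (pderiv S) sq * [:0, 2:]" for S
    by (simp add: pderiv_pcompose sq')
  have Rb: "poly R (b\<^sup>2) = 0" "poly (pderiv R) (b\<^sup>2) = e ^ M"
    by (simp_all add: R_def p_def pderiv_mult pderiv_pCons poly_power del: mult_pCons_left)
  have k': "k = 0 \<or> k = 1" using k by auto
  show ?thesis
  proof (rule hermite_zero_ge)
    show "poly q b = 0" using Rb by (simp add: q_def poly_pcompose sq)
    show "poly (pderiv q) b > 0"
      using k' b e Rb by (auto simp: q_def pderiv_mult comp poly_pcompose sq pderiv_pCons)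
    fix u assume u: "b \<le> u"
    then have u2: "b\<^sup>2 \<le> u\<^sup>2" using b by (intro power_mono) auto
    have "u\<^sup>2 * poly (pderiv (pderiv R)) (u\<^sup>2) + (real k + 1 / 2 - u\<^sup>2) * poly (pderiv R) (u\<^sup>2)
        + (real M + 1) * poly R (u\<^sup>2) \<ge> 0"
      unfolding R_def p_def by (rule poly_subsolution[OF e slope cY u2])
    then have "4 * u ^ k * (u\<^sup>2 * poly (pderiv (pderiv R)) (u\<^sup>2)
        + (real k + 1 / 2 - u\<^sup>2) * poly (pderiv R) (u\<^sup>2) + (real M + 1) * poly R (u\<^sup>2)) \<ge> 0"
      (is "?L \<ge> 0") using u b by (intro mult_nonneg_nonneg) auto
    also have "?L = poly (pderiv (pderiv q)) u - 2 * u * poly (pderiv q) u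
        + 2 * real (2 * (M + 1) + k) * poly q u"
      using k' by (auto simp: q_def pderiv_mult pderiv_add pderiv_smult comp poly_pcompose sq pderiv_pCons
          power2_eq_square algebra_simps)
    finally show "poly (pderiv (pderiv q)) u - 2 * u * poly (pderiv q) u
        + 2 * real (2 * (M + 1) + k) * poly q u \<ge> 0" .
  qed
qed

text \<open>With \<open>e\<close> determined by \<open>e * (b\<^sup>2 - a) = 2 * M * b\<^sup>2\<close>, the remaining conditions on \<open>Y = b\<^sup>2\<close> read
\<open>b\<^sup>2 - a \<ge> 2 * M\<close> and \<open>(M + 1) * (b\<^sup>2 - a) * (b\<^sup>2 - a - M) \<le> 2 * M\<^sup>2 * b\<^sup>2\<close>. To leading order the
second one is \<open>b\<^sup>2 \<le> 3 * M\<close>, that is \<open>b\<^sup>2 \<le> 3 / 2 * n\<close>, which explains the constant \<open>sqrt (3 / 2)\<close>.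
For \<open>n = 3\<close> the bound is the largest zero itself.\<close>
lemma hermite_zero_lower_bound:
  assumes n: "n \<ge> 3"
  shows "\<exists>z\<ge>sqrt (3 / 2) * ((real n - 1) / sqrt (real n + 1)). poly (hermite_poly n) z = 0"
proof -
  define b where "b = sqrt (3 / 2) * ((real n - 1) / sqrt (real n + 1))"
  define k where "k = n mod 2"
  define M where "M = n div 2 - 1"
  have nMk: "n = 2 * (M + 1) + k" using n unfolding M_def k_def by presburger
  have rn: "real n = 2 * real M + 2 + real k" by (simp add: nMk)
  have k: "k = 0 \<or> k = 1" by (auto simp: k_def)
  have b: "b > 0" using n by (simp add: b_def)
  have b2: "b\<^sup>2 = 3 / 2 * (real n - 1)\<^sup>2 / (real n + 1)"
    by (simp add: b_def power_mult_distrib power_divide)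
  show ?thesis
  proof (cases "M = 0")
    case True
    \<comment> \<open>Here \<open>b\<^sup>2 = a\<close>, so the condition on \<open>e\<close> is void and any value in \<open>{0<..b\<^sup>2}\<close> will do.\<close>
    then have "n = 3" "k = 1" using n nMk k by auto
    then have "b\<^sup>2 = 3 / 2" by (simp add: b2)
    then have "\<exists>z\<ge>b. poly (hermite_poly n) z = 0"
      using hermite_zero_ge_of_params[of k b "3 / 2" M] True \<open>k = 1\<close> \<open>n = 3\<close> b by simp
    then show ?thesis by (simp add: b_def)
  next
    case False
    then have M: "real M \<ge> 1" by simp
    let ?a = "real k + 1 / 2"
    let ?x = "real M"
    have "b\<^sup>2 - ?a \<ge> 2 * ?x \<and> (?x + 1) * (b\<^sup>2 - ?a) * (b\<^sup>2 - ?a - ?x) \<le> 2 * ?x\<^sup>2 * b\<^sup>2"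
      using k
    proof
      assume "k = 0"
      then have B: "b\<^sup>2 = 3 / 2 * (2 * ?x + 1)\<^sup>2 / (2 * ?x + 3)"
        by (simp add: b2 rn algebra_simps)
      have B1: "b\<^sup>2 - ?a = ?x * (6 * ?x + 5) / (2 * ?x + 3)"
        using \<open>k = 0\<close> unfolding B by (simp add: field_simps power2_eq_square)
      have B2: "b\<^sup>2 - ?a - ?x = 2 * ?x * (2 * ?x + 1) / (2 * ?x + 3)"
        unfolding B1 by (simp add: field_simps)
      have "(?x + 1) * (6 * ?x + 5) \<le> 3 / 2 * (2 * ?x + 1) * (2 * ?x + 3)"
        using M by (simp add: algebra_simps)
      from mult_left_mono[OF this, of "2 * ?x\<^sup>2 * (2 * ?x + 1) / (2 * ?x + 3)\<^sup>2"]
      have ineq: "2 * ?x\<^sup>2 * (2 * ?x + 1) / (2 * ?x + 3)\<^sup>2 * ((?x + 1) * (6 * ?x + 5))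
          \<le> 2 * ?x\<^sup>2 * (2 * ?x + 1) / (2 * ?x + 3)\<^sup>2 * (3 / 2 * (2 * ?x + 1) * (2 * ?x + 3))"
        by simp
      have left: "(?x + 1) * (?x * (6 * ?x + 5) / D) * (2 * ?x * (2 * ?x + 1) / D)
          = 2 * ?x\<^sup>2 * (2 * ?x + 1) / D\<^sup>2 * ((?x + 1) * (6 * ?x + 5))" for D
        by (simp add: power2_eq_square ac_simps)
      have right: "2 * ?x\<^sup>2 * (3 / 2 * (2 * ?x + 1)\<^sup>2 / D)
          = 2 * ?x\<^sup>2 * (2 * ?x + 1) / D\<^sup>2 * (3 / 2 * (2 * ?x + 1) * D)" if "D > 0" for D
        using that by (simp add: power2_eq_square field_simps)
      have "(?x + 1) * (b\<^sup>2 - ?a) * (b\<^sup>2 - ?a - ?x) \<le> 2 * ?x\<^sup>2 * b\<^sup>2"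
        unfolding B2 unfolding B1 unfolding B left by (subst right) (simp, rule ineq)
      moreover have "2 * ?x * (2 * ?x + 3) \<le> ?x * (6 * ?x + 5)"
        using mult_right_mono[OF M, of ?x] by (simp add: algebra_simps)
      then have "b\<^sup>2 - ?a \<ge> 2 * ?x" unfolding B1 by (simp add: pos_le_divide_eq)
      ultimately show ?thesis by blast
    next
      assume "k = 1"
      then have B: "b\<^sup>2 = 3 * (?x + 1)\<^sup>2 / (?x + 2)"
        unfolding b2 rn by (simp add: field_simps power2_eq_square)
      have B1: "b\<^sup>2 - ?a = 3 / 2 * ?x * (2 * ?x + 3) / (?x + 2)"
        using \<open>k = 1\<close> unfolding B by (simp add: field_simps power2_eq_square)
      have B2: "b\<^sup>2 - ?a - ?x = ?x * (2 * ?x + 5 / 2) / (?x + 2)"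
        unfolding B1 by (simp add: field_simps)
      have "(2 * ?x + 3) * (2 * ?x + 5 / 2) \<le> 4 * (?x + 1) * (?x + 2)"
        by (simp add: algebra_simps)
      from mult_left_mono[OF this, of "3 / 2 * ?x\<^sup>2 * (?x + 1) / (?x + 2)\<^sup>2"]
      have ineq: "3 / 2 * ?x\<^sup>2 * (?x + 1) / (?x + 2)\<^sup>2 * ((2 * ?x + 3) * (2 * ?x + 5 / 2))
          \<le> 3 / 2 * ?x\<^sup>2 * (?x + 1) / (?x + 2)\<^sup>2 * (4 * (?x + 1) * (?x + 2))"
        by simp
      have left: "(?x + 1) * (3 / 2 * ?x * (2 * ?x + 3) / D) * (?x * (2 * ?x + 5 / 2) / D)
          = 3 / 2 * ?x\<^sup>2 * (?x + 1) / D\<^sup>2 * ((2 * ?x + 3) * (2 * ?x + 5 / 2))" for D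
        by (cases "D = 0") (simp_all add: power2_eq_square field_simps)
      have right: "2 * ?x\<^sup>2 * (3 * (?x + 1)\<^sup>2 / D)
          = 3 / 2 * ?x\<^sup>2 * (?x + 1) / D\<^sup>2 * (4 * (?x + 1) * D)" if "D > 0" for D
        using that by (simp add: power2_eq_square field_simps)
      have "(?x + 1) * (b\<^sup>2 - ?a) * (b\<^sup>2 - ?a - ?x) \<le> 2 * ?x\<^sup>2 * b\<^sup>2"
        unfolding B2 unfolding B1 unfolding B left by (subst right) (simp, rule ineq)
      moreover have "2 * ?x * (?x + 2) \<le> 3 / 2 * ?x * (2 * ?x + 3)"
        using mult_right_mono[OF M, of ?x] by (simp add: algebra_simps)
      then have "b\<^sup>2 - ?a \<ge> 2 * ?x" unfolding B1 by (simp add: pos_le_divide_eq algebra_simps)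
      ultimately show ?thesis by blast
    qed
    then have low: "b\<^sup>2 - ?a \<ge> 2 * ?x"
      and key: "(?x + 1) * (b\<^sup>2 - ?a) * (b\<^sup>2 - ?a - ?x) \<le> 2 * ?x\<^sup>2 * b\<^sup>2"
      by auto
    define e where "e = 2 * real M * b\<^sup>2 / (b\<^sup>2 - ?a)"
    have pos: "b\<^sup>2 - ?a > 0" using low M by linarith
    have "\<exists>z\<ge>b. poly (hermite_poly (2 * (M + 1) + k)) z = 0"
    proof (rule hermite_zero_ge_of_params)
      show "e > 0" using M b pos by (simp add: e_def)
      show "e * (b\<^sup>2 - ?a) = 2 * real M * b\<^sup>2" using pos by (simp add: e_def)
      show "e \<le> b\<^sup>2"
        using mult_right_mono[OF low, of "b\<^sup>2"] pos unfolding e_def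
        by (subst pos_divide_le_eq) (auto simp: mult.commute)
      have swap: "b\<^sup>2 - real M - ?a = b\<^sup>2 - ?a - real M" by simp
      have "(real M + 1) * (b\<^sup>2 - real M - ?a) * (b\<^sup>2 - ?a) \<le> 2 * (real M)\<^sup>2 * b\<^sup>2"
        using key by (simp only: swap mult_ac)
      then have "(real M + 1) * (b\<^sup>2 - real M - ?a) \<le> 2 * (real M)\<^sup>2 * b\<^sup>2 / (b\<^sup>2 - ?a)"
        using pos by (simp add: pos_le_divide_eq)
      also have "\<dots> = real M * e" by (simp add: e_def power2_eq_square)
      finally show "(real M + 1) * (b\<^sup>2 - real M - ?a) \<le> real M * e" .
    qed (use k b in auto)
    then show ?thesis by (simp add: b_def nMk)
  qed
qed

section \<open>The Zak transform as a real series\<close>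

lemma deriv_funpow_gaussian:
  "(deriv ^^ n) (\<lambda>t::real. exp (- 2 * pi * t\<^sup>2))
     = (\<lambda>x. (- sqrt (2 * pi)) ^ n * poly (hermite_poly n) (sqrt (2 * pi) * x) * exp (- 2 * pi * x\<^sup>2))"
proof (induction n)
  case 0
  then show ?case by simp
next
  case (Suc n)
  define s where "s = sqrt (2 * pi)"
  have s2: "s * s = 2 * pi" by (simp add: s_def)
  let ?P = "hermite_poly n"
  have "((\<lambda>x. (- s) ^ n * poly ?P (s * x) * exp (- 2 * pi * x\<^sup>2)) has_real_derivative
      (- s) ^ Suc n * poly (hermite_poly (Suc n)) (s * x) * exp (- 2 * pi * x\<^sup>2)) (at x)" for x
  proof -
    have "((\<lambda>x. poly ?P (s * x)) has_real_derivative poly (pderiv ?P) (s * x) * s) (at x)"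
      by (rule DERIV_chain'[where f = "\<lambda>x. s * x"]) (auto intro!: derivative_eq_intros)
    then have "((\<lambda>x. (- s) ^ n * poly ?P (s * x) * exp (- 2 * pi * x\<^sup>2)) has_real_derivative
      (- s) ^ n * (poly (pderiv ?P) (s * x) * s) * exp (- 2 * pi * x\<^sup>2)
       + (- s) ^ n * poly ?P (s * x) * (exp (- 2 * pi * x\<^sup>2) * (- 2 * (s * s) * x))) (at x)"
      unfolding s2 by (auto intro!: derivative_eq_intros simp: algebra_simps)
    then show ?thesis by (simp add: algebra_simps)
  qed
  then show ?case
    unfolding funpow.simps o_def Suc s_def[symmetric] by (intro ext DERIV_imp_deriv)
qed

lemma hermite_fun_eq:
  obtains K where "\<And>x. hermite_fun n x = K * hermite_psi n (sqrt (2 * pi) * x)"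
proof
  fix x
  have "exp (- (sqrt (2 * pi) * x)\<^sup>2 / 2) = exp (pi * x\<^sup>2) * exp (- 2 * pi * x\<^sup>2)"
    by (simp add: power_mult_distrib flip: exp_add)
  then show "hermite_fun n x = ((- 1) ^ n * hermite_const n powr (- 1 / 2) * (- sqrt (2 * pi)) ^ n)
      * hermite_psi n (sqrt (2 * pi) * x)"
    unfolding hermite_fun_def deriv_funpow_gaussian hermite_psi_def gauss_def
    by (simp only: mult_ac)
qed

text \<open>The summands with indices \<open>j\<close> and \<open>- j - 1\<close> sit at \<open>\<mu> * (d * j + 1)\<close> and \<open>- \<mu> * (d * j + d - 1)\<close>;
reflecting the second point always produces a minus sign relative to the first summand, as the parity
of \<open>h\<close> and the phase compensate.\<close>
definition zak_pair :: "nat \<Rightarrow> real \<Rightarrow> nat \<Rightarrow> real \<Rightarrow> real" where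
  "zak_pair n d j \<mu> = hermite_psi n (\<mu> * (d * real j + 1)) - hermite_psi n (\<mu> * (d * real j + d - 1))"

definition zak_series :: "nat \<Rightarrow> real \<Rightarrow> real \<Rightarrow> real" where
  "zak_series n d \<mu> = (\<Sum>j. (- 1) ^ (Suc n * j) * zak_pair n d j \<mu>)"

lemma hermite_psi_bound:
  obtains C where "C \<ge> 0" "\<forall>u\<ge>0. \<bar>hermite_psi n u\<bar> \<le> C * exp (- u)"
  using gauss_bound[of "hermite_poly n"] unfolding hermite_psi_def by blast

text \<open>A geometric majorant that is uniform in \<open>\<mu> \<ge> \<mu>0\<close>: it gives absolute convergence of the series and,
by the Weierstrass test, continuity in \<open>\<mu>\<close>.\<close>
lemma hermite_psi_progression_bound:
  assumes C: "C \<ge> 0" "\<forall>u\<ge>0. \<bar>hermite_psi n u\<bar> \<le> C * exp (- u)"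
    and \<mu>: "\<mu> \<ge> \<mu>0" "\<mu>0 \<ge> 0" and v: "v \<ge> real j"
  shows "\<bar>hermite_psi n (\<mu> * v)\<bar> \<le> C * exp (- \<mu>0) ^ j"
proof -
  have "\<mu>0 * real j \<le> \<mu> * v" using \<mu> v by (intro mult_mono) auto
  moreover have "0 \<le> \<mu> * v" using \<mu> v by simp
  ultimately have "C * exp (- (\<mu> * v)) \<le> C * exp (- \<mu>0) ^ j"
    using C(1) by (intro mult_left_mono) (auto simp: exp_of_nat_mult[symmetric] mult.commute)
  then show ?thesis using C(2) \<open>0 \<le> \<mu> * v\<close> by (meson order.trans)
qed

lemma progression_ge:
  fixes d :: real
  assumes "d \<ge> 4"
  shows "d * real j + 1 \<ge> real j" "d * real j + d - 1 \<ge> real j"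
  using mult_right_mono[OF assms, of "real j"] assms by auto

lemma has_sum_int_folded:
  fixes f :: "int \<Rightarrow> 'a::banach"
  assumes "summable (\<lambda>j. norm (f (int j)))" "summable (\<lambda>j. norm (f (- int j - 1)))"
  shows "(f has_sum ((\<Sum>j. f (int j)) + (\<Sum>j. f (- int j - 1)))) UNIV"
proof -
  have 1: "(f has_sum (\<Sum>j. f (int j))) (range int)"
    by (subst has_sum_reindex)
      (auto simp: o_def intro!: norm_summable_imp_has_sum assms summable_sums summable_norm_cancel)
  have 2: "(f has_sum (\<Sum>j. f (- int j - 1))) (range (\<lambda>j. - int j - 1))"
    by (subst has_sum_reindex)
      (auto simp: o_def inj_on_def intro!: norm_summable_imp_has_sum assms summable_sums
        summable_norm_cancel)
  have "range int \<union> range (\<lambda>j. - int j - 1) = UNIV"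
  proof (intro equalityI subsetI UNIV_I)
    fix k :: int
    have "k = int (nat k) \<or> k = - int (nat (- k - 1)) - 1" by linarith
    then show "k \<in> range int \<union> range (\<lambda>j. - int j - 1)" by blast
  qed
  moreover have "range int \<inter> range (\<lambda>j. - int j - 1) = {}" by auto
  ultimately show ?thesis using has_sum_Un_disjoint[OF 1 2] by simp
qed

text \<open>The condition on \<open>\<gamma>\<close> covers both frequencies: \<open>\<gamma> = 1 / 2\<close> has phase \<open>- 1\<close> and is paired with even
\<open>n\<close>, while \<open>\<gamma> = 0\<close> has phase \<open>1\<close> and is paired with odd \<open>n\<close>.\<close>
lemma zak_eq_zak_series:
  fixes d :: real
  assumes d: "d \<ge> 4" and l: "l > 0"
    and \<gamma>: "exp (- 2 * complex_of_real pi * \<i> * complex_of_real \<gamma>) = (- 1) ^ Suc n"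
    and hK: "\<And>x. hermite_fun n x = K * hermite_psi n (sqrt (2 * pi) * x)"
  shows "zak l (\<lambda>x. complex_of_real (hermite_fun n x)) (1 / d) \<gamma>
    = complex_of_real (sqrt l * K * zak_series n d (sqrt (2 * pi) * l / d))"
proof -
  define \<mu> where "\<mu> = sqrt (2 * pi) * l / d"
  have \<mu>: "\<mu> > 0" using d l by (simp add: \<mu>_def)
  define f where "f = (\<lambda>k::int. K * hermite_psi n (\<mu> * (1 + d * of_int k)) * (- 1) powi (int (Suc n) * k))"
  have phase: "exp (- 2 * complex_of_real pi * \<i> * of_int k * complex_of_real \<gamma>)
      = of_real ((- 1) powi (int (Suc n) * k))" for k
  proof -
    have "exp (- 2 * complex_of_real pi * \<i> * of_int k * complex_of_real \<gamma>)
        = exp (- 2 * complex_of_real pi * \<i> * complex_of_real \<gamma>) powi k"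
      by (simp add: exp_power_int algebra_simps)
    then show ?thesis unfolding \<gamma> by (simp add: power_int_mult flip: power_int_of_nat)
  qed
  have point: "sqrt (2 * pi) * (l * (1 / d + of_int k)) = \<mu> * (1 + d * of_int k)" for k
    using d by (simp add: \<mu>_def field_simps)
  have zak: "zak l (\<lambda>x. complex_of_real (hermite_fun n x)) (1 / d) \<gamma>
      = of_real (sqrt l) * (\<Sum>\<^sub>\<infinity>k. of_real (f k))"
    unfolding zak_def hK point phase f_def by simp
  have right: "f (int j) = K * ((- 1) ^ (Suc n * j) * hermite_psi n (\<mu> * (d * real j + 1)))" for j
  proof -
    have "(- 1 :: real) powi (int (Suc n) * int j) = (- 1) ^ (Suc n * j)"
      by (simp only: of_nat_mult [symmetric] power_int_of_nat)
    then show ?thesis by (simp add: f_def add.commute)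
  qed
  have left: "f (- int j - 1)
      = - (K * ((- 1) ^ (Suc n * j) * hermite_psi n (\<mu> * (d * real j + d - 1))))" for j
  proof -
    have reflected: "\<mu> * (1 + d * of_int (- int j - 1)) = - (\<mu> * (d * real j + d - 1))"
      by (simp add: algebra_simps)
    have exponent: "int (Suc n) * (- int j - 1) = - int (Suc n * Suc j)"
      by (simp add: algebra_simps)
    have sign: "(- 1 :: real) powi (int (Suc n) * (- int j - 1)) * (- 1) ^ n = - ((- 1) ^ (Suc n * j))"
      unfolding exponent power_int_minus power_int_of_nat
      by (cases "even n"; cases "even j") auto
    have "f (- int j - 1) = K * hermite_psi n (\<mu> * (d * real j + d - 1))
        * ((- 1) powi (int (Suc n) * (- int j - 1)) * (- 1) ^ n)"
      unfolding f_def reflected hermite_psi_parity by (simp only: mult_ac)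
    then show ?thesis unfolding sign by simp
  qed
  obtain C where C: "C \<ge> 0" "\<forall>u\<ge>0. \<bar>hermite_psi n u\<bar> \<le> C * exp (- u)"
    using hermite_psi_bound by blast
  have bound: "summable (\<lambda>j. \<bar>hermite_psi n (\<mu> * v j)\<bar>)" if "\<And>j. v j \<ge> real j" for v
  proof (rule summable_comparison_test')
    show "summable (\<lambda>j. C * exp (- \<mu>) ^ j)"
      using \<mu> by (intro summable_mult summable_geometric) simp
    show "norm \<bar>hermite_psi n (\<mu> * v j)\<bar> \<le> C * exp (- \<mu>) ^ j" if "j \<ge> 0" for j
      using hermite_psi_progression_bound[OF C, of \<mu> \<mu> j "v j"] \<mu> \<open>\<And>j. v j \<ge> real j\<close> by simp
  qed
  note sr = bound[of "\<lambda>j. d * real j + 1", OF progression_ge(1)[OF d]]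
  note sl = bound[of "\<lambda>j. d * real j + d - 1", OF progression_ge(2)[OF d]]
  have sr': "summable (\<lambda>j. norm (f (int j)))"
    unfolding right using summable_mult[OF sr, of "\<bar>K\<bar>"] by (simp add: abs_mult)
  have sl': "summable (\<lambda>j. norm (f (- int j - 1)))"
    unfolding left using summable_mult[OF sl, of "\<bar>K\<bar>"] by (simp add: abs_mult)
  have sum0: "summable (\<lambda>j. (- 1) ^ (Suc n * j) * hermite_psi n (\<mu> * (d * real j + 1)))"
    "summable (\<lambda>j. (- 1) ^ (Suc n * j) * hermite_psi n (\<mu> * (d * real j + d - 1)))"
    by (rule summable_norm_cancel, use sr sl in \<open>simp add: abs_mult\<close>)+
  have "(\<Sum>j. f (int j))
      = K * (\<Sum>j. (- 1) ^ (Suc n * j) * hermite_psi n (\<mu> * (d * real j + 1)))"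
    unfolding right by (rule suminf_mult[OF sum0(1)])
  moreover have "(\<Sum>j. f (- int j - 1))
      = - (K * (\<Sum>j. (- 1) ^ (Suc n * j) * hermite_psi n (\<mu> * (d * real j + d - 1))))"
    unfolding left suminf_minus[OF summable_mult[OF sum0(2)]] suminf_mult[OF sum0(2)] ..
  moreover have "zak_series n d \<mu>
      = (\<Sum>j. (- 1) ^ (Suc n * j) * hermite_psi n (\<mu> * (d * real j + 1)))
        - (\<Sum>j. (- 1) ^ (Suc n * j) * hermite_psi n (\<mu> * (d * real j + d - 1)))"
    unfolding zak_series_def zak_pair_def
    by (subst suminf_diff[OF sum0]) (simp only: right_diff_distrib)
  ultimately have "(\<Sum>j. f (int j)) + (\<Sum>j. f (- int j - 1)) = K * zak_series n d \<mu>"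
    by (simp only: right_diff_distrib)
  with has_sum_int_folded[OF sr' sl'] have "(f has_sum K * zak_series n d \<mu>) UNIV" by simp
  then have "((\<lambda>k. complex_of_real (f k)) has_sum of_real (K * zak_series n d \<mu>)) UNIV"
    by (rule has_sum_of_real)
  then show ?thesis unfolding zak \<mu>_def[symmetric] by (simp add: infsumI)
qed

lemma continuous_on_zak_series:
  fixes d :: real
  assumes d: "d \<ge> 4" and \<mu>0: "\<mu>0 > 0"
  shows "continuous_on {\<mu>0..} (zak_series n d)"
proof -
  obtain C where C: "C \<ge> 0" "\<forall>u\<ge>0. \<bar>hermite_psi n u\<bar> \<le> C * exp (- u)"
    using hermite_psi_bound by blast
  have "uniform_limit {\<mu>0..} (\<lambda>N \<mu>. \<Sum>j<N. (- 1) ^ (Suc n * j) * zak_pair n d j \<mu>)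
      (\<lambda>\<mu>. \<Sum>j. (- 1) ^ (Suc n * j) * zak_pair n d j \<mu>) sequentially"
  proof (rule Weierstrass_m_test)
    fix j \<mu> assume "\<mu> \<in> {\<mu>0..}"
    then have \<mu>: "\<mu> \<ge> \<mu>0" by simp
    note b = hermite_psi_progression_bound[OF C \<mu> less_imp_le[OF \<mu>0]]
    have "\<bar>zak_pair n d j \<mu>\<bar> \<le> C * exp (- \<mu>0) ^ j + C * exp (- \<mu>0) ^ j"
      unfolding zak_pair_def
      by (rule order.trans[OF abs_triangle_ineq4 add_mono[OF b[OF progression_ge(1)[OF d]]
            b[OF progression_ge(2)[OF d]]]])
    then show "norm ((- 1) ^ (Suc n * j) * zak_pair n d j \<mu>) \<le> 2 * C * exp (- \<mu>0) ^ j"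
      by (simp add: abs_mult)
  next
    show "summable (\<lambda>j. 2 * C * exp (- \<mu>0) ^ j)"
      using \<mu>0 by (intro summable_mult summable_geometric) simp
  qed
  moreover have "continuous_on {\<mu>0..} (\<lambda>\<mu>. \<Sum>j<N. (- 1) ^ (Suc n * j) * zak_pair n d j \<mu>)" for N
  proof -
    have "continuous_on UNIV (hermite_psi n)"
      unfolding hermite_psi_def by (rule DERIV_continuous_on[OF gauss_deriv])
    then have "continuous_on {\<mu>0..} (\<lambda>\<mu>. hermite_psi n (\<mu> * v))" for v
      by (rule continuous_on_compose2) (auto intro!: continuous_intros)
    then show ?thesis
      unfolding zak_pair_def by (intro continuous_on_sum continuous_on_mult_left continuous_on_diff)
  qed
  ultimately show ?thesis
    unfolding zak_series_def[abs_def]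
    by (intro uniform_limit_theorem[where F = sequentially]) auto
qed

section \<open>The sign change\<close>

text \<open>For \<open>j \<ge> 1\<close> the pair with index \<open>j\<close> is bounded by its first member, as \<open>h\<close> is nonnegative and nonincreasing
there, and this member is evaluated at distance at least \<open>2 * \<mu> * j\<close> beyond \<open>v\<close>. By exponential decay
it is at most \<open>exp (- 2 * \<mu>) ^ j * h v\<close>, and the powers of \<open>exp (- 2 * \<mu>) \<le> 1 / 3\<close> sum to at most
\<open>1 / 2\<close>, regardless of the signs in the series.\<close>
lemma zak_series_approx:
  fixes d w \<mu> :: real
  defines "v \<equiv> \<mu> * (d - 1)"
  assumes d: "d \<ge> 4" and \<mu>: "\<mu> \<ge> 1"
    and pos: "\<And>u. u \<ge> w \<Longrightarrow> hermite_psi n u \<ge> 0"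
    and w: "w \<ge> 0" "w\<^sup>2 \<ge> 2 * real n + 2" "w \<le> v"
  shows "\<bar>zak_series n d \<mu> - (hermite_psi n \<mu> - hermite_psi n v)\<bar> \<le> hermite_psi n v / 2"
proof -
  define a where "a = (\<lambda>j. (- 1) ^ (Suc n * j) * zak_pair n d j \<mu>)"
  define q where "q = exp (- 2 * \<mu>)"
  have "1 + 2 * \<mu> \<le> exp (2 * \<mu>)" by (rule exp_ge_add_one_self)
  then have "3 \<le> exp (2 * \<mu>)" using \<mu> by linarith
  then have "q \<le> 1 / 3" by (simp add: q_def exp_minus field_simps)
  moreover have "q > 0" by (simp add: q_def)
  ultimately have q: "q > 0" "q \<le> 1 / 3" by auto
  have hv: "hermite_psi n v \<ge> 0" using pos w by simp
  have decay: "hermite_psi n y \<le> exp (- (y - x)) * hermite_psi n x" if "w \<le> x" "x \<le> y" for x y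
    using hermite_psi_decay[of w n 1 x y] pos w that by simp
  have term_bound: "norm (a (Suc j)) \<le> hermite_psi n v * q * q ^ j" for j
  proof -
    let ?x = "\<mu> * (d * real (Suc j) + 1)" and ?y = "\<mu> * (d * real (Suc j) + d - 1)"
    have "(d - 4) * real j \<ge> 0" using d by simp
    then have gap: "2 * real (Suc j) \<le> d * real (Suc j) + 1 - (d - 1)"
      by (simp add: algebra_simps)
    have x: "2 * \<mu> * real (Suc j) \<le> ?x - v"
      using mult_left_mono[OF gap, of \<mu>] \<mu> by (simp add: v_def algebra_simps)
    have vx: "v \<le> ?x" using x \<mu> by (smt (verit) mult_nonneg_nonneg of_nat_0_le_iff)
    have xy: "?x \<le> ?y" using d \<mu> by simp
    have "hermite_psi n ?y \<le> exp (- (?y - ?x)) * hermite_psi n ?x"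
      using decay[OF order.trans[OF w(3) vx] xy] .
    also have "\<dots> \<le> 1 * hermite_psi n ?x"
      using xy pos[of ?x] w vx by (intro mult_right_mono) auto
    finally have "hermite_psi n ?y \<le> hermite_psi n ?x" by simp
    moreover have "hermite_psi n ?y \<ge> 0" using pos[of ?y] w vx xy by linarith
    ultimately have "norm (a (Suc j)) \<le> hermite_psi n ?x"
      by (simp add: a_def zak_pair_def abs_mult)
    also have "\<dots> \<le> exp (- (?x - v)) * hermite_psi n v" by (rule decay[OF w(3) vx])
    also have "\<dots> \<le> exp (- (2 * \<mu> * real (Suc j))) * hermite_psi n v"
      using x hv by (intro mult_right_mono) auto
    also have "exp (- (2 * \<mu> * real (Suc j))) = q ^ Suc j"
      unfolding q_def exp_of_nat_mult [symmetric] by (simp add: algebra_simps)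
    finally show ?thesis by (simp add: mult_ac)
  qed
  have geo: "(\<lambda>j. hermite_psi n v * q * q ^ j) sums (hermite_psi n v * q * (1 / (1 - q)))"
    using q by (intro sums_mult geometric_sums) simp
  have sum: "summable (\<lambda>j. a (Suc j))"
    by (rule summable_comparison_test'[OF sums_summable[OF geo]]) (rule term_bound)
  have "norm (\<Sum>j. a (Suc j)) \<le> (\<Sum>j. hermite_psi n v * q * q ^ j)"
    by (rule norm_suminf_le[OF term_bound sums_summable[OF geo]])
  also have "\<dots> = hermite_psi n v * (q / (1 - q))" using sums_unique[OF geo] by simp
  also have "\<dots> \<le> hermite_psi n v * (1 / 2)"
    using q hv by (intro mult_left_mono) (auto simp: field_simps)
  finally have tail: "\<bar>\<Sum>j. a (Suc j)\<bar> \<le> hermite_psi n v / 2" by simp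
  have "summable a" using sum by (simp add: summable_Suc_iff)
  then have "zak_series n d \<mu> = a 0 + (\<Sum>j. a (Suc j))"
    unfolding zak_series_def a_def[symmetric] using suminf_split_head[of a] by simp
  moreover have "a 0 = hermite_psi n \<mu> - hermite_psi n v"
    by (simp add: a_def zak_pair_def v_def)
  ultimately show ?thesis using tail by simp
qed

text \<open>The largest zero lies before the turning point, since beyond it a positive solution that tends to \<open>0\<close>
is nonincreasing and cannot start from the value \<open>0\<close>.\<close>
lemma hermite_largest_zero:
  assumes "n \<ge> 3"
  obtains z where "sqrt (3 / 2) * ((real n - 1) / sqrt (real n + 1)) \<le> z"
    and "z < sqrt (2 * real n + 1)" "hermite_psi n z = 0"
    and "\<And>u. u > z \<Longrightarrow> hermite_psi n u > 0"
proof -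
  define b where "b = sqrt (3 / 2) * ((real n - 1) / sqrt (real n + 1))"
  define Z where "Z = {u. poly (hermite_poly n) u = 0}"
  obtain z0 where z0: "b \<le> z0" "z0 \<in> Z"
    using hermite_zero_lower_bound[OF assms] by (auto simp: b_def Z_def)
  have "hermite_poly n \<noteq> 0" using lead_coeff_hermite[of n] by auto
  then have fin: "finite Z" unfolding Z_def by (rule poly_roots_finite)
  define z where "z = Max Z"
  have z: "z \<in> Z" "b \<le> z" using Max_in[OF fin] Max_ge[OF fin z0(2)] z0 by (auto simp: z_def)
  have zero: "hermite_psi n z = 0" using z by (simp add: Z_def hermite_psi_eq_0_iff)
  have pos: "hermite_psi n u > 0" if "u > z" for u
  proof -
    have "poly (hermite_poly n) x \<noteq> 0" if "x \<ge> u" for x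
      using Max_ge[OF fin, of x] that \<open>u > z\<close> by (auto simp: Z_def z_def)
    then show ?thesis
      using hermite_pos_beyond_zeros[of u n u] by (simp add: hermite_psi_pos_iff)
  qed
  have "z < sqrt (2 * real n + 1)"
  proof (rule ccontr)
    assume "\<not> z < sqrt (2 * real n + 1)"
    then have T: "sqrt (2 * real n + 1) \<le> z" by simp
    have "z \<ge> 0" using T by (rule order.trans[rotated]) simp
    moreover have "2 * real n + 1 \<le> z\<^sup>2" using power_mono[OF T, of 2] by simp
    moreover have "hermite_psi n u \<ge> 0" if "u \<ge> z" for u
      using pos[of u] zero that by (cases "u = z") auto
    ultimately have "hermite_psi n (z + 1) \<le> hermite_psi n z"
      using hermite_psi_decay[of z n 0 z "z + 1"] by simp
    with pos[of "z + 1"] zero show False by simp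
  qed
  then show ?thesis using that z zero pos unfolding b_def by blast
qed

text \<open>At the largest zero \<open>z\<close> only \<open>- h (z * (d - 1))\<close> and its correction remain. This point lies at \<open>3 * z\<close>
or further, where \<open>(3 * z)\<^sup>2 \<ge> 9 * b\<^sup>2 \<ge> 2 * n + 2\<close> already guarantees exponential decay. At the turning
point \<open>T\<close> decay over \<open>{2 * T..3 * T}\<close> makes the second term at most a third of \<open>h T\<close>.\<close>
lemma zak_series_zero:
  fixes d :: real
  assumes n: "n \<ge> 3" and d: "d \<ge> 4"
  obtains \<mu> where "sqrt (3 / 2) * ((real n - 1) / sqrt (real n + 1)) < \<mu>"
    and "\<mu> < sqrt (2 * real n + 1)" "zak_series n d \<mu> = 0"
proof -
  define b where "b = sqrt (3 / 2) * ((real n - 1) / sqrt (real n + 1))"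
  define T where "T = sqrt (2 * real n + 1)"
  obtain z where z: "b \<le> z" "z < T" "hermite_psi n z = 0"
    and pos: "\<And>u. u > z \<Longrightarrow> hermite_psi n u > 0"
    using hermite_largest_zero[OF n] unfolding b_def T_def by blast
  have nonneg: "hermite_psi n u \<ge> 0" if "u \<ge> z" for u
    using pos[of u] z(3) that by (cases "u = z") auto
  have b2: "b\<^sup>2 = 3 / 2 * (real n - 1)\<^sup>2 / (real n + 1)"
    by (simp add: b_def power_mult_distrib power_divide)
  have b0: "b \<ge> 0" using n by (simp add: b_def)
  have big: "9 * b\<^sup>2 \<ge> 2 * real n + 2"
  proof -
    have "real n \<ge> 3" using n by simp
    then have le: "2 * (real n + 1) \<le> 4 * (real n - 1)" by (simp add: algebra_simps)
    have "(2 * (real n + 1)) * (2 * (real n + 1)) \<le> (4 * (real n - 1)) * (4 * (real n - 1))"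
      using n by (intro mult_mono[OF le le]) auto
    then have "(2 * real n + 2) * (real n + 1) \<le> 9 * (3 / 2 * (real n - 1)\<^sup>2)"
      using n by (simp add: power2_eq_square algebra_simps)
    then show ?thesis unfolding b2 by (simp add: field_simps)
  qed
  have b1: "b \<ge> 1"
  proof (rule ccontr)
    assume "\<not> b \<ge> 1"
    then have "b\<^sup>2 < 1" using b0 by (simp add: abs_square_less_1)
    then have "\<not> real n \<ge> 4" using big by linarith
    then have "n = 3" using n by linarith
    then show False using \<open>b\<^sup>2 < 1\<close> by (simp add: b2)
  qed
  have T: "T\<^sup>2 = 2 * real n + 1" "T \<ge> 2"
    unfolding T_def using n by (auto intro!: real_le_rsqrt)
  have neg: "zak_series n d z < 0"
  proof -
    define v where "v = z * (d - 1)"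
    have v: "3 * z \<le> v" unfolding v_def using mult_left_mono[of 3 "d - 1" z] d z b1 by simp
    have "b\<^sup>2 \<le> z\<^sup>2" using z b1 by (intro power_mono) auto
    then have "2 * real n + 2 \<le> (3 * z)\<^sup>2" using big by (simp add: power_mult_distrib)
    then have "\<bar>zak_series n d z - (hermite_psi n z - hermite_psi n v)\<bar> \<le> hermite_psi n v / 2"
      using zak_series_approx[OF d, of z "3 * z" n] nonneg z b1 v unfolding v_def by simp
    moreover have "hermite_psi n v > 0" using pos[of v] v z b1 by simp
    ultimately show ?thesis using z(3) unfolding abs_le_iff by linarith
  qed
  have pos_T: "zak_series n d T > 0"
  proof -
    define v where "v = T * (d - 1)"
    have v: "3 * T \<le> v" unfolding v_def using mult_left_mono[of 3 "d - 1" T] d T by simp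
    have "2 * 2 \<le> T * T" using T(2) by (intro mult_mono) auto
    then have w: "2 * real n + 2 \<le> (2 * T)\<^sup>2"
      using T(1) by (simp add: power_mult_distrib power2_eq_square)
    have "\<bar>zak_series n d T - (hermite_psi n T - hermite_psi n v)\<bar> \<le> hermite_psi n v / 2"
      using zak_series_approx[OF d, of T "2 * T" n] nonneg z T v w unfolding v_def by simp
    moreover have "hermite_psi n v \<le> hermite_psi n T / 3"
    proof -
      have "hermite_psi n v \<le> exp (- 1 * (v - 2 * T)) * hermite_psi n (2 * T)"
        by (rule hermite_psi_decay[of "2 * T"]) (use nonneg z T v w in auto)
      also have "\<dots> \<le> (1 / 3) * hermite_psi n (2 * T)"
      proof (rule mult_right_mono)
        have "3 \<le> exp (v - 2 * T)" using exp_ge_add_one_self[of "v - 2 * T"] v T by linarith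
        moreover have "exp (- 1 * x) = 1 / exp x" for x :: real by (simp add: exp_minus divide_inverse)
        ultimately show "exp (- 1 * (v - 2 * T)) \<le> 1 / 3"
          using frac_le[of 1 1 3 "exp (v - 2 * T)"] by (simp only:)
        show "hermite_psi n (2 * T) \<ge> 0" using nonneg z T by simp
      qed
      also have "hermite_psi n (2 * T) \<le> hermite_psi n T"
        using hermite_psi_decay[of T n 0 T "2 * T"] nonneg z T by simp
      finally show ?thesis by simp
    qed
    moreover have "hermite_psi n T > 0" using pos z by simp
    ultimately show ?thesis unfolding abs_le_iff by linarith
  qed
  have "continuous_on {z..T} (zak_series n d)"
    by (rule continuous_on_subset[OF continuous_on_zak_series[OF d, of z]]) (use z b1 in auto)
  then obtain \<mu> where \<mu>: "z \<le> \<mu>" "\<mu> \<le> T" "zak_series n d \<mu> = 0"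
    using IVT'[of "zak_series n d" z 0 T] neg pos_T z by auto
  moreover have "\<mu> \<noteq> z" "\<mu> \<noteq> T" using \<mu> neg pos_T by auto
  ultimately show ?thesis using that[of \<mu>] z unfolding b_def T_def by auto
qed

lemma zak_hermite_zero:
  fixes d :: real
  assumes n: "n \<ge> 3" and d: "d \<ge> 4"
    and \<gamma>: "exp (- 2 * complex_of_real pi * \<i> * complex_of_real \<gamma>) = (- 1) ^ Suc n"
  shows "\<exists>l>0. zak l (\<lambda>x. complex_of_real (hermite_fun n x)) (1 / d) \<gamma> = 0
           \<and> lambda_bounds n (1 / d) l"
proof -
  define s where "s = sqrt (2 * pi)"
  have s: "s > 0" by (simp add: s_def)
  obtain K where K: "\<And>x. hermite_fun n x = K * hermite_psi n (sqrt (2 * pi) * x)"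
    using hermite_fun_eq by blast
  obtain \<mu> where \<mu>: "sqrt (3 / 2) * ((real n - 1) / sqrt (real n + 1)) < \<mu>"
    "\<mu> < sqrt (2 * real n + 1)" "zak_series n d \<mu> = 0"
    using zak_series_zero[OF n d] by blast
  have "0 \<le> sqrt (3 / 2) * ((real n - 1) / sqrt (real n + 1))" using n by simp
  then have "\<mu> > 0" using \<mu>(1) by linarith
  define l where "l = d / s * \<mu>"
  have l: "l > 0" using \<open>\<mu> > 0\<close> s d by (simp add: l_def)
  have "s * l / d = \<mu>" using s d by (simp add: l_def)
  then have "zak l (\<lambda>x. complex_of_real (hermite_fun n x)) (1 / d) \<gamma> = 0"
    using zak_eq_zak_series[OF d l \<gamma> K] \<mu>(3) by (simp add: s_def)
  moreover have "lambda_bounds n (1 / d) l"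
  proof -
    have "d / s > 0" using s d by simp
    from mult_strict_left_mono[OF \<mu>(1) this] mult_strict_left_mono[OF \<mu>(2) this]
    show ?thesis
      unfolding lambda_bounds_def s_def[symmetric] l_def by (simp add: mult_ac)
  qed
  ultimately show ?thesis using l by blast
qed

theorem mainTheorem6:
  shows "(\<forall>n::nat. even n \<and> n \<ge> 4 \<longrightarrow>
      (\<exists>l1 l2 :: real. l1 > 0 \<and> l2 > 0 \<and>
         zak l1 (\<lambda>x. complex_of_real (hermite_fun n x)) (1/4) (1/2) = 0 \<and>
         zak l2 (\<lambda>x. complex_of_real (hermite_fun n x)) (1/6) (1/2) = 0 \<and>
         lambda_bounds n (1/4) l1 \<and> lambda_bounds n (1/6) l2)) \<and>
    (\<forall>n::nat. odd n \<and> n \<ge> 3 \<longrightarrow>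
      (\<exists>l3 l4 :: real. l3 > 0 \<and> l4 > 0 \<and>
         zak l3 (\<lambda>x. complex_of_real (hermite_fun n x)) (1/6) 0 = 0 \<and>
         zak l4 (\<lambda>x. complex_of_real (hermite_fun n x)) (1/4) 0 = 0 \<and>
         lambda_bounds n (1/6) l3 \<and> lambda_bounds n (1/4) l4))"
proof (intro conjI allI impI)
  fix n :: nat assume n: "even n \<and> n \<ge> 4"
  have "exp (- (complex_of_real pi * \<i>)) = - 1"
    by (simp add: exp_minus mult.commute[of _ \<i>])
  then have "exp (- 2 * complex_of_real pi * \<i> * complex_of_real (1 / 2)) = (- 1) ^ Suc n"
    using n by simp
  from zak_hermite_zero[OF _ _ this, of 4] zak_hermite_zero[OF _ _ this, of 6] n
  show "\<exists>l1 l2 :: real. l1 > 0 \<and> l2 > 0 \<and>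
         zak l1 (\<lambda>x. complex_of_real (hermite_fun n x)) (1/4) (1/2) = 0 \<and>
         zak l2 (\<lambda>x. complex_of_real (hermite_fun n x)) (1/6) (1/2) = 0 \<and>
         lambda_bounds n (1/4) l1 \<and> lambda_bounds n (1/6) l2"
    by auto
next
  fix n :: nat assume n: "odd n \<and> n \<ge> 3"
  then have "exp (- 2 * complex_of_real pi * \<i> * complex_of_real 0) = (- 1) ^ Suc n"
    by simp
  from zak_hermite_zero[OF _ _ this, of 4] zak_hermite_zero[OF _ _ this, of 6] n
  show "\<exists>l3 l4 :: real. l3 > 0 \<and> l4 > 0 \<and>
         zak l3 (\<lambda>x. complex_of_real (hermite_fun n x)) (1/6) 0 = 0 \<and>
         zak l4 (\<lambda>x. complex_of_real (hermite_fun n x)) (1/4) 0 = 0 \<and>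
         lambda_bounds n (1/6) l3 \<and> lambda_bounds n (1/4) l4"
    by auto
qed

end
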